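(* Let $A$ be a $\mathbf{k}$-algebra and $(V,\ell,r)$ be an $A$-bimodule, both of finite dimension over $\mathbf{k}$. Let $\alpha:V\to A$ be a linear map, let $\hat A=A\ltimes_{r^*,\ell^*}V^*$ and let $\tilde\alpha_-=\alpha-\alpha^{21}\in\hat A\otimes\hat A$. Put $u\ast_\alpha v:=\ell(\alpha(u))v+u\,r(\alpha(v))$ for $u,v\in V$. Then $\tilde\alpha_-$ is a skew-symmetric solution of the generalized associative Yang-Baxter equation in $\hat A$ if and only if the following equations hold for all $u,v,w\in V$ and $x\in A$: $$\ell\big(\alpha(u)\alpha(v)-\alpha(u\ast_\alpha v)\big)w=u\,r\big(\alpha(v)\alpha(w)-\alpha(v\ast_\alpha w)\big),$$ $$\alpha(u)\alpha(\ell(x)v)-\alpha(u\ast_\alpha(\ell(x)v))=\alpha(u\,r(x))\alpha(v)-\alpha((u\,r(x))\ast_\alpha v),$$ $$\alpha(u)\alpha(v\,r(x))-\alpha(u\ast_\alpha(v\,r(x)))=(\alpha(u)\alpha(v))x-\alpha(u\ast_\alpha v)x,$$ $$\alpha(\ell(x)u)\alpha(v)-\alpha((\ell(x)u)\ast_\alpha v)=x(\alpha(u)\alpha(v))-x\,\alpha(u\ast_\alpha v).$$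
   Context: $\mathbf{k}$ is a field; a $\mathbf{k}$-algebra is associative, not necessarily unital. An $A$-bimodule $(V,\ell,r)$ is a vector space with linear maps $\ell,r:A\to\mathrm{End}_{\mathbf{k}}(V)$ (left, right) with $\ell(xy)v=\ell(x)(\ell(y)v)$, $v\,r(xy)=(v\,r(x))r(y)$, $(\ell(x)v)r(y)=\ell(x)(v\,r(y))$. Its dual bimodule $(V^*,r^*,\ell^* )$ has left action $\langle r^*(x)u^*,v\rangle=\langle u^*,v\,r(x)\rangle$ and right action $\langle u^*\ell^*(x),v\rangle=\langle u^*,\ell(x)v\rangle$. $\hat A=A\ltimes_{r^*,\ell^*}V^*$ is the algebra $A\oplus V^*$ with product $(x,u^* )(y,v^* )=(xy,\,r^*(x)v^*+u^*\ell^*(y))$. A linear map $\alpha:V\to A$ is identified with $\alpha=\sum_i\alpha(e_i)\otimes e_i^*\in A\otimes V^*\subset\hat A\otimes\hat A$, for a basis $(e_i)$ of $V$ with dual basis $(e_i^* )$, and $\alpha^{21}=\sum_i e_i^*\otimes\alpha(e_i)$. For an algebra $C$, an element $r=\sum_i a_i\otimes b_i\in C\otimes C$ is a solution of the generalized associative Yang-Baxter equation (GAYBE) in $C$ if $(\mathrm{id}\otimes\mathrm{id}\otimes L(x)-R(x)\otimes\mathrm{id}\otimes\mathrm{id})(r_{12}r_{13}+r_{13}r_{23}-r_{23}r_{12})=0$ for all $x\in C$, where $r_{12}r_{13}=\sum_{i,j}a_ia_j\otimes b_i\otimes b_j$, $r_{13}r_{23}=\sum_{i,j}a_i\otimes a_j\otimes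 b_ib_j$, $r_{23}r_{12}=\sum_{i,j}a_i\otimes a_jb_i\otimes b_j$, and $(\mathrm{id}\otimes\mathrm{id}\otimes L(x)-R(x)\otimes\mathrm{id}\otimes\mathrm{id})(p\otimes q\otimes s)=p\otimes q\otimes xs-px\otimes q\otimes s$. Skew-symmetric means $\sum_i b_i\otimes a_i=-r$. *)

theory Defs
  imports Complex_Main "HOL-Library.Poly_Mapping" "HOL-Library.Function_Algebras"
    "HOL-Library.Product_Plus"
begin

section \<open>Algebras and bimodules\<close>

text \<open>
  Algebras are associative and not necessarily unital. The algebra lives on a subspace \<open>C\<close> of
  an ambient vector space, because the dual space (and hence the semidirect product below) is a
  proper subspace of a function type.
\<close>

locale algebra_on = vector_space scale
  for scale :: "'k::field \<Rightarrow> 'c::ab_group_add \<Rightarrow> 'c" +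
  fixes C :: "'c set" and mul :: "'c \<Rightarrow> 'c \<Rightarrow> 'c"
  assumes subspace_carrier: "subspace C"
    and mul_closed: "x \<in> C \<Longrightarrow> y \<in> C \<Longrightarrow> mul x y \<in> C"
    and mul_add_left: "x \<in> C \<Longrightarrow> y \<in> C \<Longrightarrow> z \<in> C \<Longrightarrow> mul (x + y) z = mul x z + mul y z"
    and mul_add_right: "x \<in> C \<Longrightarrow> y \<in> C \<Longrightarrow> z \<in> C \<Longrightarrow> mul x (y + z) = mul x y + mul x z"
    and mul_scale_left: "x \<in> C \<Longrightarrow> y \<in> C \<Longrightarrow> mul (scale c x) y = scale c (mul x y)"
    and mul_scale_right: "x \<in> C \<Longrightarrow> y \<in> C \<Longrightarrow> mul x (scale c y) = scale c (mul x y)"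
    and mul_assoc: "x \<in> C \<Longrightarrow> y \<in> C \<Longrightarrow> z \<in> C \<Longrightarrow> mul (mul x y) z = mul x (mul y z)"

text \<open>The right action is written prefix: \<open>r x v\<close> stands for \<open>v r(x)\<close>.\<close>

locale bimodule = A: algebra_on sA UNIV "(*)" + V: vector_space sV
  for sA :: "'k::field \<Rightarrow> 'a::ring \<Rightarrow> 'a" and sV :: "'k \<Rightarrow> 'v::ab_group_add \<Rightarrow> 'v" +
  fixes l r :: "'a \<Rightarrow> 'v \<Rightarrow> 'v"
  assumes l_linear: "Vector_Spaces.linear sV sV (l x)"
    and r_linear: "Vector_Spaces.linear sV sV (r x)"
    and l_add: "l (x + y) v = l x v + l y v"
    and r_add: "r (x + y) v = r x v + r y v"
    and l_scale: "l (sA c x) v = sV c (l x v)"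
    and r_scale: "r (sA c x) v = sV c (r x v)"
    and l_mult: "l (x * y) v = l x (l y v)"
    and r_mult: "r (x * y) v = r y (r x v)"
    and l_r_commute: "r y (l x v) = l x (r y v)"

definition dual_space :: "('k::field \<Rightarrow> 'v::ab_group_add \<Rightarrow> 'v) \<Rightarrow> ('v \<Rightarrow> 'k) set" where
  "dual_space sV = {f. Vector_Spaces.linear sV (*) f}"

definition dual_left :: "('a \<Rightarrow> 'v \<Rightarrow> 'v) \<Rightarrow> 'a \<Rightarrow> ('v \<Rightarrow> 'k) \<Rightarrow> ('v \<Rightarrow> 'k)" where
  "dual_left r x f = (\<lambda>v. f (r x v))"

definition dual_right :: "('a \<Rightarrow> 'v \<Rightarrow> 'v) \<Rightarrow> 'a \<Rightarrow> ('v \<Rightarrow> 'k) \<Rightarrow> ('v \<Rightarrow> 'k)" where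
  "dual_right l x f = (\<lambda>v. f (l x v))"

text \<open>
  The semidirect product of \<open>A\<close> with the dual bimodule; addition on
  pairs and on functions is componentwise and pointwise, respectively.
\<close>

definition semidirect_carrier ::
    "('k::field \<Rightarrow> 'v::ab_group_add \<Rightarrow> 'v) \<Rightarrow> ('a \<times> ('v \<Rightarrow> 'k)) set" where
  "semidirect_carrier sV = UNIV \<times> dual_space sV"

definition semidirect_scale ::
    "('k::field \<Rightarrow> 'a \<Rightarrow> 'a) \<Rightarrow> 'k \<Rightarrow> 'a \<times> ('v \<Rightarrow> 'k) \<Rightarrow> 'a \<times> ('v \<Rightarrow> 'k)" where
  "semidirect_scale sA c = (\<lambda>(x, f). (sA c x, \<lambda>v. c * f v))"

definition semidirect_mul ::
    "('a::ring \<Rightarrow> 'v \<Rightarrow> 'v) \<Rightarrow> ('a \<Rightarrow> 'v \<Rightarrow> 'v) \<Rightarrow>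
      'a \<times> ('v \<Rightarrow> 'k::field) \<Rightarrow> 'a \<times> ('v \<Rightarrow> 'k) \<Rightarrow> 'a \<times> ('v \<Rightarrow> 'k)" where
  "semidirect_mul l r = (\<lambda>(x, f) (y, g). (x * y, dual_left r x g + dual_right l y f))"

lemma dual_spaceD:
  assumes "f \<in> dual_space sV"
  shows "f (u + v) = f u + f v" "f (sV c v) = c * f v"
  using assms unfolding dual_space_def by (auto simp: Vector_Spaces.linear_iff)

lemma (in vector_space) dual_spaceI:
  assumes "\<And>u v. f (u + v) = f u + f v" "\<And>c v. f (scale c v) = c * f v"
  shows "f \<in> dual_space scale"
  using assms vector_space_axioms unfolding dual_space_def
  by (auto simp: Vector_Spaces.linear_iff vector_space_def algebra_simps)

context bimodule
begin

lemma linear_simps: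
  "l x (u + v) = l x u + l x v" "l x (sV c v) = sV c (l x v)"
  "r x (u + v) = r x u + r x v" "r x (sV c v) = sV c (r x v)"
  using l_linear[of x] r_linear[of x] by (auto simp: Vector_Spaces.linear_iff)

lemma semidirect_algebra_on:
  "algebra_on (semidirect_scale sA) (semidirect_carrier sV) (semidirect_mul l r)"
proof -
  interpret H: vector_space "semidirect_scale sA :: 'k \<Rightarrow> 'a \<times> ('v \<Rightarrow> 'k) \<Rightarrow> 'a \<times> ('v \<Rightarrow> 'k)"
    by unfold_locales
      (auto simp: semidirect_scale_def A.scale_right_distrib A.scale_left_distrib algebra_simps
        fun_eq_iff plus_prod_def)
  have D: "0 \<in> dual_space sV"
    by (rule V.dual_spaceI) auto
  have D': "f + g \<in> dual_space sV" "(\<lambda>v. c * f v) \<in> dual_space sV"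
    "dual_left r x f \<in> dual_space sV" "dual_right l x f \<in> dual_space sV"
    if "f \<in> dual_space sV" "g \<in> dual_space sV" for f g :: "'v \<Rightarrow> 'k" and c x
    by (rule V.dual_spaceI; simp add: dual_left_def dual_right_def linear_simps
        dual_spaceD[OF that(1)] dual_spaceD[OF that(2)] algebra_simps)+
  have scale: "sA c x * y = sA c (x * y)" "x * sA c y = sA c (x * y)" for c x y
    using A.mul_scale_left A.mul_scale_right by auto
  note defs = semidirect_carrier_def semidirect_scale_def semidirect_mul_def
    dual_left_def dual_right_def
  show ?thesis
  proof
    show "H.subspace (semidirect_carrier sV)"
      using D D' by (auto simp: H.subspace_def semidirect_carrier_def semidirect_scale_def
          zero_prod_def)
  next
    fix X Y :: "'a \<times> ('v \<Rightarrow> 'k)"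
    assume "X \<in> semidirect_carrier sV" "Y \<in> semidirect_carrier sV"
    then obtain x f y g where XY: "X = (x, f)" "Y = (y, g)"
      and f: "f \<in> dual_space sV" and g: "g \<in> dual_space sV"
      by (auto simp: semidirect_carrier_def)
    show "semidirect_mul l r X Y \<in> semidirect_carrier sV"
      using D' f g by (simp add: XY semidirect_carrier_def semidirect_mul_def)
    fix c
    show "semidirect_mul l r (semidirect_scale sA c X) Y =
        semidirect_scale sA c (semidirect_mul l r X Y)"
      "semidirect_mul l r X (semidirect_scale sA c Y) =
        semidirect_scale sA c (semidirect_mul l r X Y)"
      by (simp_all add: XY defs scale fun_eq_iff l_scale r_scale dual_spaceD[OF f]
          dual_spaceD[OF g] algebra_simps)
    fix Z :: "'a \<times> ('v \<Rightarrow> 'k)" assume "Z \<in> semidirect_carrier sV"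
    then obtain z h where Z: "Z = (z, h)" and h: "h \<in> dual_space sV"
      by (auto simp: semidirect_carrier_def)
    show "semidirect_mul l r (X + Y) Z = semidirect_mul l r X Z + semidirect_mul l r Y Z"
      "semidirect_mul l r X (Y + Z) = semidirect_mul l r X Y + semidirect_mul l r X Z"
      "semidirect_mul l r (semidirect_mul l r X Y) Z =
        semidirect_mul l r X (semidirect_mul l r Y Z)"
      by (simp_all add: XY Z defs fun_eq_iff l_add r_add l_mult r_mult l_r_commute
          dual_spaceD[OF f] dual_spaceD[OF g] dual_spaceD[OF h] algebra_simps)
  qed
qed

end


section \<open>Tensor products\<close>

text \<open>
  \<open>C \<otimes> C\<close> and \<open>C \<otimes> C \<otimes> C\<close> are quotients of the free vector spaces on \<open>C \<times> C\<close> and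
  \<open>C \<times> C \<times> C\<close> by the multilinearity relations. A tensor is given by a representative in the
  free vector space (the basis element \<open>\<langle>(a, b)\<rangle>\<close> standing for \<open>a \<otimes> b\<close>), and equality of
  tensors is congruence modulo the span of the relations.
\<close>

definition pure_tensor :: "'b \<Rightarrow> 'b \<Rightarrow>\<^sub>0 'k::field" (\<open>\<langle>_\<rangle>\<close>) where
  "\<langle>p\<rangle> = Poly_Mapping.single p 1"

definition free_scale :: "'k::field \<Rightarrow> ('b \<Rightarrow>\<^sub>0 'k) \<Rightarrow> ('b \<Rightarrow>\<^sub>0 'k)" where
  "free_scale c = Poly_Mapping.map ((*) c)"

lemma lookup_free_scale [simp]:
  "Poly_Mapping.lookup (free_scale c f) p = c * Poly_Mapping.lookup f p"
  unfolding free_scale_def by transfer (auto simp: when_def)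

global_interpretation free: vector_space free_scale
  by unfold_locales (auto intro!: poly_mapping_eqI simp: lookup_add algebra_simps)

definition free_extend :: "('b \<Rightarrow> 'd \<Rightarrow>\<^sub>0 'k) \<Rightarrow> ('b \<Rightarrow>\<^sub>0 'k::field) \<Rightarrow> 'd \<Rightarrow>\<^sub>0 'k" where
  "free_extend h f =
    (\<Sum>p\<in>Poly_Mapping.keys f. free_scale (Poly_Mapping.lookup f p) (h p))"

definition tensor2_relations ::
    "('k::field \<Rightarrow> 'c::ab_group_add \<Rightarrow> 'c) \<Rightarrow> 'c set \<Rightarrow> ('c \<times> 'c \<Rightarrow>\<^sub>0 'k) set" where
  "tensor2_relations scale C =
    {\<langle>(x + x', y)\<rangle> - \<langle>(x, y)\<rangle> - \<langle>(x', y)\<rangle> | x x' y. x \<in> C \<and> x' \<in> C \<and> y \<in> C} \<union>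
    {\<langle>(x, y + y')\<rangle> - \<langle>(x, y)\<rangle> - \<langle>(x, y')\<rangle> | x y y'. x \<in> C \<and> y \<in> C \<and> y' \<in> C} \<union>
    {\<langle>(scale c x, y)\<rangle> - free_scale c \<langle>(x, y)\<rangle> | c x y. x \<in> C \<and> y \<in> C} \<union>
    {\<langle>(x, scale c y)\<rangle> - free_scale c \<langle>(x, y)\<rangle> | c x y. x \<in> C \<and> y \<in> C}"

definition tensor3_relations ::
    "('k::field \<Rightarrow> 'c::ab_group_add \<Rightarrow> 'c) \<Rightarrow> 'c set \<Rightarrow> ('c \<times> 'c \<times> 'c \<Rightarrow>\<^sub>0 'k) set" where
  "tensor3_relations scale C =
    {\<langle>(x + x', y, z)\<rangle> - \<langle>(x, y, z)\<rangle> - \<langle>(x', y, z)\<rangle> | x x' y z. x \<in> C \<and> x' \<in> C \<and> y \<in> C \<and> z \<in> C} \<union>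
    {\<langle>(x, y + y', z)\<rangle> - \<langle>(x, y, z)\<rangle> - \<langle>(x, y', z)\<rangle> | x y y' z. x \<in> C \<and> y \<in> C \<and> y' \<in> C \<and> z \<in> C} \<union>
    {\<langle>(x, y, z + z')\<rangle> - \<langle>(x, y, z)\<rangle> - \<langle>(x, y, z')\<rangle> | x y z z'. x \<in> C \<and> y \<in> C \<and> z \<in> C \<and> z' \<in> C} \<union>
    {\<langle>(scale c x, y, z)\<rangle> - free_scale c \<langle>(x, y, z)\<rangle> | c x y z. x \<in> C \<and> y \<in> C \<and> z \<in> C} \<union>
    {\<langle>(x, scale c y, z)\<rangle> - free_scale c \<langle>(x, y, z)\<rangle> | c x y z. x \<in> C \<and> y \<in> C \<and> z \<in> C} \<union>
    {\<langle>(x, y, scale c z)\<rangle> - free_scale c \<langle>(x, y, z)\<rangle> | c x y z. x \<in> C \<and> y \<in> C \<and> z \<in> C}"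

definition tensor2 :: "'c set \<Rightarrow> ('c \<times> 'c \<Rightarrow>\<^sub>0 'k::field) set" where
  "tensor2 C = {f. Poly_Mapping.keys f \<subseteq> C \<times> C}"

definition tensor2_eq ::
    "('k::field \<Rightarrow> 'c::ab_group_add \<Rightarrow> 'c) \<Rightarrow> 'c set \<Rightarrow>
      ('c \<times> 'c \<Rightarrow>\<^sub>0 'k) \<Rightarrow> ('c \<times> 'c \<Rightarrow>\<^sub>0 'k) \<Rightarrow> bool" where
  "tensor2_eq scale C f g \<longleftrightarrow> f - g \<in> free.span (tensor2_relations scale C)"

definition tensor3_eq ::
    "('k::field \<Rightarrow> 'c::ab_group_add \<Rightarrow> 'c) \<Rightarrow> 'c set \<Rightarrow>
      ('c \<times> 'c \<times> 'c \<Rightarrow>\<^sub>0 'k) \<Rightarrow> ('c \<times> 'c \<times> 'c \<Rightarrow>\<^sub>0 'k) \<Rightarrow> bool" where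
  "tensor3_eq scale C f g \<longleftrightarrow> f - g \<in> free.span (tensor3_relations scale C)"

definition tensor_flip :: "('c \<times> 'c \<Rightarrow>\<^sub>0 'k::field) \<Rightarrow> ('c \<times> 'c \<Rightarrow>\<^sub>0 'k)" where
  "tensor_flip = free_extend (\<lambda>(a, b). \<langle>(b, a)\<rangle>)"


section \<open>The generalized associative Yang-Baxter equation\<close>

definition r12_r13 ::
    "('c \<Rightarrow> 'c \<Rightarrow> 'c) \<Rightarrow> ('c \<times> 'c \<Rightarrow>\<^sub>0 'k::field) \<Rightarrow> ('c \<times> 'c \<times> 'c \<Rightarrow>\<^sub>0 'k)" where
  "r12_r13 mul t = free_extend (\<lambda>(a, b). free_extend (\<lambda>(a', b'). \<langle>(mul a a', b, b')\<rangle>) t) t"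

definition r13_r23 ::
    "('c \<Rightarrow> 'c \<Rightarrow> 'c) \<Rightarrow> ('c \<times> 'c \<Rightarrow>\<^sub>0 'k::field) \<Rightarrow> ('c \<times> 'c \<times> 'c \<Rightarrow>\<^sub>0 'k)" where
  "r13_r23 mul t = free_extend (\<lambda>(a, b). free_extend (\<lambda>(a', b'). \<langle>(a, a', mul b b')\<rangle>) t) t"

definition r23_r12 ::
    "('c \<Rightarrow> 'c \<Rightarrow> 'c) \<Rightarrow> ('c \<times> 'c \<Rightarrow>\<^sub>0 'k::field) \<Rightarrow> ('c \<times> 'c \<times> 'c \<Rightarrow>\<^sub>0 'k)" where
  "r23_r12 mul t = free_extend (\<lambda>(a, b). free_extend (\<lambda>(a', b'). \<langle>(a, mul a' b, b')\<rangle>) t) t"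

text \<open>The operator \<open>id \<otimes> id \<otimes> L(x) - R(x) \<otimes> id \<otimes> id\<close>.\<close>

definition LR_op ::
    "('c \<Rightarrow> 'c \<Rightarrow> 'c) \<Rightarrow> 'c \<Rightarrow> ('c \<times> 'c \<times> 'c \<Rightarrow>\<^sub>0 'k::field) \<Rightarrow> ('c \<times> 'c \<times> 'c \<Rightarrow>\<^sub>0 'k)" where
  "LR_op mul x = free_extend (\<lambda>(p, q, s). \<langle>(p, q, mul x s)\<rangle> - \<langle>(mul p x, q, s)\<rangle>)"

definition GAYBE_solution ::
    "('k::field \<Rightarrow> 'c::ab_group_add \<Rightarrow> 'c) \<Rightarrow> 'c set \<Rightarrow> ('c \<Rightarrow> 'c \<Rightarrow> 'c) \<Rightarrow>
      ('c \<times> 'c \<Rightarrow>\<^sub>0 'k) \<Rightarrow> bool" where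
  "GAYBE_solution scale C mul t \<longleftrightarrow> t \<in> tensor2 C \<and>
    (\<forall>x\<in>C. tensor3_eq scale C
      (LR_op mul x (r12_r13 mul t + r13_r23 mul t - r23_r12 mul t)) 0)"

definition skew_symmetric ::
    "('k::field \<Rightarrow> 'c::ab_group_add \<Rightarrow> 'c) \<Rightarrow> 'c set \<Rightarrow> ('c \<times> 'c \<Rightarrow>\<^sub>0 'k) \<Rightarrow> bool" where
  "skew_symmetric scale C t \<longleftrightarrow> t \<in> tensor2 C \<and> tensor2_eq scale C (tensor_flip t) (- t)"

text \<open>Both notions depend only on the tensor, not on its representative.\<close>

lemma free_extend_superset:
  assumes "finite S" "Poly_Mapping.keys f \<subseteq> S"
  shows "free_extend h f = (\<Sum>p\<in>S. free_scale (Poly_Mapping.lookup f p) (h p))"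
  unfolding free_extend_def
  by (rule sum.mono_neutral_left) (use assms in \<open>auto simp: in_keys_iff\<close>)

lemma free_extend_add: "free_extend h (f + g) = free_extend h f + free_extend h g"
proof -
  let ?S = "Poly_Mapping.keys f \<union> Poly_Mapping.keys g"
  have "Poly_Mapping.keys (f + g) \<subseteq> ?S" by (rule Poly_Mapping.keys_add)
  then show ?thesis
    by (simp add: free_extend_superset[of ?S] lookup_add free.scale_left_distrib sum.distrib)
qed

lemma free_extend_scale: "free_extend h (free_scale c f) = free_scale c (free_extend h f)"
proof -
  have "Poly_Mapping.keys (free_scale c f) \<subseteq> Poly_Mapping.keys f" by (auto simp: in_keys_iff)
  then show ?thesis
    by (simp add: free_extend_superset[of "Poly_Mapping.keys f"] free.scale_sum_right)
qed

lemma free_extend_diff: "free_extend h (f - g) = free_extend h f - free_extend h g"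
  using free_extend_add[of h "f - g" g] by simp

lemma free_extend_pure_tensor [simp]: "free_extend h \<langle>p\<rangle> = h p"
  by (simp add: free_extend_def pure_tensor_def)

lemma free_extend_diff_fun: "free_extend (\<lambda>p. g p - h p) f = free_extend g f - free_extend h f"
  by (simp add: free_extend_def free.scale_right_diff_distrib sum_subtractf)

lemma free_extend_scale_fun: "free_extend (\<lambda>p. free_scale c (h p)) f = free_scale c (free_extend h f)"
  by (simp add: free_extend_def free.scale_sum_right mult.commute)

lemma free_extend_swap:
  "free_extend (\<lambda>p. free_extend (h p) g) f = free_extend (\<lambda>q. free_extend (\<lambda>p. h p q) f) g"
  unfolding free_extend_def free.scale_sum_right
  by (subst sum.swap) (simp add: mult.commute)

lemma free_extend_in_span:
  assumes "\<And>p. p \<in> Poly_Mapping.keys f \<Longrightarrow> h p \<in> free.span R"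
  shows "free_extend h f \<in> free.span R"
  unfolding free_extend_def by (intro free.span_sum free.span_scale assms)

lemma free_extend_span:
  assumes "\<And>f. f \<in> R \<Longrightarrow> free_extend h f \<in> free.span S" "f \<in> free.span R"
  shows "free_extend h f \<in> free.span S"
  using assms(2)
proof (induction rule: free.span_induct_alt)
  case base
  then show ?case by (simp add: free_extend_def free.span_zero)
next
  case (step c x y)
  then show ?case
    by (simp add: free_extend_add free_extend_scale free.span_add free.span_scale assms(1))
qed

lemma tensor2_relations_cases:
  assumes "f \<in> tensor2_relations scale C"
  obtains (add1) x x' y where "f = \<langle>(x + x', y)\<rangle> - \<langle>(x, y)\<rangle> - \<langle>(x', y)\<rangle>" "x \<in> C" "x' \<in> C" "y \<in> C"
  | (add2) x y y' where "f = \<langle>(x, y + y')\<rangle> - \<langle>(x, y)\<rangle> - \<langle>(x, y')\<rangle>" "x \<in> C" "y \<in> C" "y' \<in> C"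
  | (scale1) c x y where "f = \<langle>(scale c x, y)\<rangle> - free_scale c \<langle>(x, y)\<rangle>" "x \<in> C" "y \<in> C"
  | (scale2) c x y where "f = \<langle>(x, scale c y)\<rangle> - free_scale c \<langle>(x, y)\<rangle>" "x \<in> C" "y \<in> C"
  using assms unfolding tensor2_relations_def
  by (elim UnE CollectE exE conjE; blast)

lemma tensor2_relations_span:
  assumes "x \<in> C" "y \<in> C"
  shows "x' \<in> C \<Longrightarrow> \<langle>(x + x', y)\<rangle> - \<langle>(x, y)\<rangle> - \<langle>(x', y)\<rangle> \<in> free.span (tensor2_relations scale C)"
    "y' \<in> C \<Longrightarrow> \<langle>(x, y + y')\<rangle> - \<langle>(x, y)\<rangle> - \<langle>(x, y')\<rangle> \<in> free.span (tensor2_relations scale C)"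
    "\<langle>(scale c x, y)\<rangle> - free_scale c \<langle>(x, y)\<rangle> \<in> free.span (tensor2_relations scale C)"
    "\<langle>(x, scale c y)\<rangle> - free_scale c \<langle>(x, y)\<rangle> \<in> free.span (tensor2_relations scale C)"
  by (rule free.span_base; unfold tensor2_relations_def; use assms in blast)+

lemma tensor3_relations_cases:
  assumes "f \<in> tensor3_relations scale C"
  obtains (add1) x x' y z where "f = \<langle>(x + x', y, z)\<rangle> - \<langle>(x, y, z)\<rangle> - \<langle>(x', y, z)\<rangle>"
      "x \<in> C" "x' \<in> C" "y \<in> C" "z \<in> C"
  | (add2) x y y' z where "f = \<langle>(x, y + y', z)\<rangle> - \<langle>(x, y, z)\<rangle> - \<langle>(x, y', z)\<rangle>"
      "x \<in> C" "y \<in> C" "y' \<in> C" "z \<in> C"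
  | (add3) x y z z' where "f = \<langle>(x, y, z + z')\<rangle> - \<langle>(x, y, z)\<rangle> - \<langle>(x, y, z')\<rangle>"
      "x \<in> C" "y \<in> C" "z \<in> C" "z' \<in> C"
  | (scale1) c x y z where "f = \<langle>(scale c x, y, z)\<rangle> - free_scale c \<langle>(x, y, z)\<rangle>"
      "x \<in> C" "y \<in> C" "z \<in> C"
  | (scale2) c x y z where "f = \<langle>(x, scale c y, z)\<rangle> - free_scale c \<langle>(x, y, z)\<rangle>"
      "x \<in> C" "y \<in> C" "z \<in> C"
  | (scale3) c x y z where "f = \<langle>(x, y, scale c z)\<rangle> - free_scale c \<langle>(x, y, z)\<rangle>"
      "x \<in> C" "y \<in> C" "z \<in> C"
  using assms unfolding tensor3_relations_def
  by (elim UnE CollectE exE conjE)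
    (erule (4) add1, erule (4) add2, erule (4) add3, erule (3) scale1, erule (3) scale2,
      erule (3) scale3)

lemma tensor3_relations_span:
  assumes "x \<in> C" "y \<in> C" "z \<in> C"
  shows "x' \<in> C \<Longrightarrow> \<langle>(x + x', y, z)\<rangle> - \<langle>(x, y, z)\<rangle> - \<langle>(x', y, z)\<rangle> \<in> free.span (tensor3_relations scale C)"
    "y' \<in> C \<Longrightarrow> \<langle>(x, y + y', z)\<rangle> - \<langle>(x, y, z)\<rangle> - \<langle>(x, y', z)\<rangle> \<in> free.span (tensor3_relations scale C)"
    "z' \<in> C \<Longrightarrow> \<langle>(x, y, z + z')\<rangle> - \<langle>(x, y, z)\<rangle> - \<langle>(x, y, z')\<rangle> \<in> free.span (tensor3_relations scale C)"
    "\<langle>(scale c x, y, z)\<rangle> - free_scale c \<langle>(x, y, z)\<rangle> \<in> free.span (tensor3_relations scale C)"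
    "\<langle>(x, scale c y, z)\<rangle> - free_scale c \<langle>(x, y, z)\<rangle> \<in> free.span (tensor3_relations scale C)"
    "\<langle>(x, y, scale c z)\<rangle> - free_scale c \<langle>(x, y, z)\<rangle> \<in> free.span (tensor3_relations scale C)"
  by (rule free.span_base; unfold tensor3_relations_def Un_iff mem_Collect_eq;
      use assms in metis)+

lemma tensor_flip_cong:
  assumes "tensor2_eq scale C f g"
  shows "tensor2_eq scale C (tensor_flip f) (tensor_flip g)"
proof -
  have "tensor_flip h \<in> free.span (tensor2_relations scale C)"
    if "h \<in> tensor2_relations scale C" for h
    using that
    by (cases rule: tensor2_relations_cases)
      (simp_all add: tensor_flip_def free_extend_diff free_extend_scale tensor2_relations_span)
  then show ?thesis
    using assms free_extend_span[of "tensor2_relations scale C"]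
    unfolding tensor2_eq_def tensor_flip_def free_extend_diff[symmetric] by metis
qed

lemma skew_symmetric_cong:
  assumes "f \<in> tensor2 C" "g \<in> tensor2 C" "tensor2_eq scale C f g"
  shows "skew_symmetric scale C f \<longleftrightarrow> skew_symmetric scale C g"
proof -
  let ?S = "free.span (tensor2_relations scale C)"
  have d: "(tensor_flip f - tensor_flip g) + (f - g) \<in> ?S"
    using tensor_flip_cong[OF assms(3)] assms(3) unfolding tensor2_eq_def
    by (rule free.span_add)
  have "tensor_flip f - - f = ((tensor_flip f - tensor_flip g) + (f - g)) + (tensor_flip g - - g)"
    by simp
  then have "tensor_flip f - - f \<in> ?S \<longleftrightarrow> tensor_flip g - - g \<in> ?S"
    using free.span_add_eq[OF d] by metis
  then show ?thesis using assms by (simp add: skew_symmetric_def tensor2_eq_def)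
qed

context algebra_on
begin

lemma LR_op_span:
  assumes "x \<in> C" "f \<in> free.span (tensor3_relations scale C)"
  shows "LR_op mul x f \<in> free.span (tensor3_relations scale C)"
  unfolding LR_op_def
proof (rule free_extend_span[OF _ assms(2)])
  let ?R = "tensor3_relations scale C"
  fix f assume f: "f \<in> ?R"
  let ?L = "free_extend (\<lambda>p. case p of (p, q, s) \<Rightarrow> \<langle>(p, q, mul x s)\<rangle>) f"
  let ?M = "free_extend (\<lambda>p. case p of (p, q, s) \<Rightarrow> \<langle>(mul p x, q, s)\<rangle>) f"
  have "?L \<in> free.span ?R" "?M \<in> free.span ?R"
    using f by (cases rule: tensor3_relations_cases; simp add: free_extend_diff free_extend_scale
        mul_add_right mul_scale_right mul_add_left mul_scale_left mul_closed assms(1)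
        tensor3_relations_span)+
  then have "?L - ?M \<in> free.span ?R" by (rule free.span_diff)
  then show "free_extend (\<lambda>(p, q, s). \<langle>(p, q, mul x s)\<rangle> - \<langle>(mul p x, q, s)\<rangle>) f \<in> free.span ?R"
    by (simp add: free_extend_diff_fun[symmetric] split_def)
qed

lemma bilinear_extension_span:
  assumes "f \<in> tensor2 C" "g \<in> tensor2 C" "f - g \<in> free.span (tensor2_relations scale C)"
    and 1: "\<And>q d. q \<in> C \<times> C \<Longrightarrow> d \<in> tensor2_relations scale C \<Longrightarrow>
      free_extend (\<lambda>p. h p q) d \<in> free.span (tensor3_relations scale C)"
    and 2: "\<And>p d. p \<in> C \<times> C \<Longrightarrow> d \<in> tensor2_relations scale C \<Longrightarrow>
      free_extend (h p) d \<in> free.span (tensor3_relations scale C)"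
  shows "free_extend (\<lambda>p. free_extend (h p) f) f - free_extend (\<lambda>p. free_extend (h p) g) g
    \<in> free.span (tensor3_relations scale C)" (is "_ \<in> ?S")
proof -
  have "free_extend (\<lambda>q. free_extend (\<lambda>p. h p q) (f - g)) f \<in> ?S"
  proof (rule free_extend_in_span)
    fix q assume "q \<in> Poly_Mapping.keys f"
    with assms(1) have "q \<in> C \<times> C" by (auto simp: tensor2_def)
    from free_extend_span[OF 1[OF this] assms(3)]
    show "free_extend (\<lambda>p. h p q) (f - g) \<in> ?S" by blast
  qed
  moreover have "free_extend (\<lambda>p. free_extend (h p) (f - g)) g \<in> ?S"
  proof (rule free_extend_in_span)
    fix p assume "p \<in> Poly_Mapping.keys g"
    with assms(2) have "p \<in> C \<times> C" by (auto simp: tensor2_def)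
    from free_extend_span[OF 2[OF this] assms(3)]
    show "free_extend (h p) (f - g) \<in> ?S" by blast
  qed
  moreover have "free_extend (\<lambda>p. free_extend (h p) f) f - free_extend (\<lambda>p. free_extend (h p) g) g =
      free_extend (\<lambda>q. free_extend (\<lambda>p. h p q) (f - g)) f +
      free_extend (\<lambda>p. free_extend (h p) (f - g)) g"
    unfolding free_extend_swap[of "\<lambda>q p. h p q"]
    by (simp add: free_extend_diff free_extend_diff_fun)
  ultimately show ?thesis by (metis free.span_add)
qed

lemma GAYBE_solution_cong:
  assumes "f \<in> tensor2 C" "g \<in> tensor2 C" "tensor2_eq scale C f g"
  shows "GAYBE_solution scale C mul f \<longleftrightarrow> GAYBE_solution scale C mul g"
proof -
  let ?S = "free.span (tensor3_relations scale C)"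
  have fg: "f - g \<in> free.span (tensor2_relations scale C)"
    using assms(3) by (simp add: tensor2_eq_def)
  note simps = free_extend_diff free_extend_scale mul_add_right mul_scale_right mul_add_left
    mul_scale_left mul_closed tensor3_relations_span split_def
  have "r12_r13 mul f - r12_r13 mul g \<in> ?S"
    unfolding r12_r13_def split_def
    by (rule bilinear_extension_span[OF assms(1,2) fg];
        erule tensor2_relations_cases; auto simp: simps)
  moreover have "r13_r23 mul f - r13_r23 mul g \<in> ?S"
    unfolding r13_r23_def split_def
    by (rule bilinear_extension_span[OF assms(1,2) fg];
        erule tensor2_relations_cases; auto simp: simps)
  moreover have "r23_r12 mul f - r23_r12 mul g \<in> ?S"
    unfolding r23_r12_def split_def
    by (rule bilinear_extension_span[OF assms(1,2) fg];
        erule tensor2_relations_cases; auto simp: simps)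
  ultimately have "(r12_r13 mul f - r12_r13 mul g) + (r13_r23 mul f - r13_r23 mul g)
      - (r23_r12 mul f - r23_r12 mul g) \<in> ?S"
    by (rule free.span_diff[OF free.span_add])
  then have d: "(r12_r13 mul f + r13_r23 mul f - r23_r12 mul f)
      - (r12_r13 mul g + r13_r23 mul g - r23_r12 mul g) \<in> ?S" (is "?F - ?G \<in> _")
    by (simp add: algebra_simps)
  have "LR_op mul x ?F \<in> ?S \<longleftrightarrow> LR_op mul x ?G \<in> ?S" if "x \<in> C" for x
  proof -
    have "LR_op mul x ?F - LR_op mul x ?G \<in> ?S"
      using LR_op_span[OF that d] by (simp add: LR_op_def free_extend_diff)
    from free.span_add_eq[OF this, of "LR_op mul x ?G"] show ?thesis by simp
  qed
  then show ?thesis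
    using assms by (simp add: GAYBE_solution_def tensor3_eq_def)
qed

end


section \<open>The tensor of a linear map \<open>V \<rightarrow> A\<close>\<close>

definition dual_basis ::
    "('k::field \<Rightarrow> 'v::ab_group_add \<Rightarrow> 'v) \<Rightarrow> 'v set \<Rightarrow> 'v \<Rightarrow> ('v \<Rightarrow> 'k)" where
  "dual_basis sV B e = (\<lambda>v. module.representation sV B v e)"

definition map_tensor ::
    "('k::field \<Rightarrow> 'v::ab_group_add \<Rightarrow> 'v) \<Rightarrow> 'v set \<Rightarrow> ('v \<Rightarrow> 'a::zero) \<Rightarrow>
      (('a \<times> ('v \<Rightarrow> 'k)) \<times> ('a \<times> ('v \<Rightarrow> 'k)) \<Rightarrow>\<^sub>0 'k)" where
  "map_tensor sV B \<alpha> = (\<Sum>e\<in>B. \<langle>((\<alpha> e, 0), (0, dual_basis sV B e))\<rangle>)"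

definition bimodule_star ::
    "('a \<Rightarrow> 'v \<Rightarrow> 'v) \<Rightarrow> ('a \<Rightarrow> 'v \<Rightarrow> 'v) \<Rightarrow> ('v \<Rightarrow> 'a) \<Rightarrow> 'v \<Rightarrow> 'v \<Rightarrow> 'v::ab_group_add" where
  "bimodule_star l r \<alpha> u v = l (\<alpha> u) v + r (\<alpha> v) u"

end

theory Submission
  imports Defs
begin

text \<open>
  A tensor over a finite-dimensional space vanishes iff all products of three linear forms vanish
  on it, and every linear form on \<open>A \<oplus> V*\<close> is \<open>\<phi>(a, f) = g(a) + f(v)\<close> with \<open>g \<in> A*\<close>, \<open>v \<in> V\<close>.
  Contracting \<open>t = \<alpha> - \<alpha>\<^sup>2\<^sup>1\<close> with \<open>\<phi>\<close> in the second factor gives \<open>s = (\<alpha>(v), - g \<circ> \<alpha>)\<close>, and \<open>- s\<close>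
  in the first factor. Hence \<open>\<phi>\<^sub>1 \<otimes> \<phi>\<^sub>2 \<otimes> \<phi>\<^sub>3\<close> takes the cyclic value
  \<open>\<phi>\<^sub>1(s\<^sub>2 s\<^sub>3) + \<phi>\<^sub>2(s\<^sub>3 s\<^sub>1) + \<phi>\<^sub>3(s\<^sub>1 s\<^sub>2)\<close> on \<open>t\<^sub>1\<^sub>2 t\<^sub>1\<^sub>3 + t\<^sub>1\<^sub>3 t\<^sub>2\<^sub>3 - t\<^sub>2\<^sub>3 t\<^sub>1\<^sub>2\<close>, which equals
  \<open>g\<^sub>1(P(v\<^sub>2, v\<^sub>3)) + g\<^sub>2(P(v\<^sub>3, v\<^sub>1)) + g\<^sub>3(P(v\<^sub>1, v\<^sub>2))\<close> for \<open>P(u, v) = \<alpha>(u) \<alpha>(v) - \<alpha>(u * v)\<close>.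
  Since \<open>\<phi>\<^sub>3 \<circ> L(x)\<close> and \<open>\<phi>\<^sub>1 \<circ> R(x)\<close> are again linear forms, this also evaluates the GAYBE, and
  varying \<open>g\<^sub>1, g\<^sub>2, g\<^sub>3\<close> and the \<open>V*\<close>-component of \<open>x\<close> separates the four identities.
\<close>

section \<open>Linear forms on tensors\<close>

text \<open>Linearity is required only on the carrier \<open>C\<close>, because \<open>H\<close>
  below is a proper subspace of its ambient type and the algebra laws are available only
  there.\<close>

definition linear_form :: "('k::field \<Rightarrow> 'c::ab_group_add \<Rightarrow> 'c) \<Rightarrow> 'c set \<Rightarrow> ('c \<Rightarrow> 'k) \<Rightarrow> bool" where
  "linear_form scale C \<phi> \<longleftrightarrow> (\<forall>x\<in>C. \<forall>y\<in>C. \<phi> (x + y) = \<phi> x + \<phi> y) \<and>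
    (\<forall>c. \<forall>x\<in>C. \<phi> (scale c x) = c * \<phi> x)"

lemma linear_formI:
  assumes "\<And>x y. x \<in> C \<Longrightarrow> y \<in> C \<Longrightarrow> \<phi> (x + y) = \<phi> x + \<phi> y"
    and "\<And>c x. x \<in> C \<Longrightarrow> \<phi> (scale c x) = c * \<phi> x"
  shows "linear_form scale C \<phi>"
  using assms by (simp add: linear_form_def)

lemma linear_formD:
  assumes "linear_form scale C \<phi>" "x \<in> C"
  shows "y \<in> C \<Longrightarrow> \<phi> (x + y) = \<phi> x + \<phi> y" "\<phi> (scale c x) = c * \<phi> x"
  using assms by (auto simp: linear_form_def)

lemma (in vector_space) linear_form_sum:
  assumes "subspace C" "linear_form scale C \<phi>" "\<And>i. i \<in> I \<Longrightarrow> x i \<in> C"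
  shows "\<phi> (\<Sum>i\<in>I. scale (c i) (x i)) = (\<Sum>i\<in>I. c i * \<phi> (x i))"
proof -
  have 0: "\<phi> 0 = 0"
    using linear_formD(2)[OF assms(2) subspace_0[OF assms(1)], of 0] by simp
  show ?thesis
    using assms(3)
  proof (induction I rule: infinite_finite_induct)
    case (insert j J)
    then have "scale (c j) (x j) \<in> C" "(\<Sum>i\<in>J. scale (c i) (x i)) \<in> C" "x j \<in> C"
      using assms(1) by (auto intro!: subspace_sum subspace_scale)
    with insert show ?case by (simp add: linear_formD[OF assms(2)])
  qed (simp_all add: 0)
qed

lemma (in vector_space) linear_form_diff:
  assumes "subspace C" "linear_form scale C \<phi>" "x \<in> C" "y \<in> C"
  shows "\<phi> (x - y) = \<phi> x - \<phi> y"
  using linear_formD(1)[OF assms(2), of "x - y" y] assms by (simp add: subspace_diff)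

lemma sum_fun_apply: "(\<Sum>i\<in>I. f i) x = (\<Sum>i\<in>I. f i x)"
  for f :: "'i \<Rightarrow> 'b \<Rightarrow> 'k::comm_monoid_add"
  by (induction I rule: infinite_finite_induct) simp_all

section \<open>Functionals on free vector spaces\<close>

definition free_eval :: "('b \<Rightarrow> 'k) \<Rightarrow> ('b \<Rightarrow>\<^sub>0 'k::field) \<Rightarrow> 'k" where
  "free_eval h f = (\<Sum>p\<in>Poly_Mapping.keys f. Poly_Mapping.lookup f p * h p)"

lemma free_eval_superset:
  assumes "finite S" "Poly_Mapping.keys f \<subseteq> S"
  shows "free_eval h f = (\<Sum>p\<in>S. Poly_Mapping.lookup f p * h p)"
  unfolding free_eval_def
  by (rule sum.mono_neutral_left) (use assms in \<open>auto simp: in_keys_iff\<close>)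

lemma free_eval_add: "free_eval h (f + g) = free_eval h f + free_eval h g"
proof -
  let ?S = "Poly_Mapping.keys f \<union> Poly_Mapping.keys g"
  have "Poly_Mapping.keys (f + g) \<subseteq> ?S" by (rule Poly_Mapping.keys_add)
  then show ?thesis
    by (simp add: free_eval_superset[of ?S] lookup_add distrib_right sum.distrib)
qed

lemma free_eval_scale: "free_eval h (free_scale c f) = c * free_eval h f"
proof -
  have "Poly_Mapping.keys (free_scale c f) \<subseteq> Poly_Mapping.keys f" by (auto simp: in_keys_iff)
  then show ?thesis
    by (simp add: free_eval_superset[of "Poly_Mapping.keys f"] sum_distrib_left mult.assoc)
qed

lemma free_eval_zero [simp]: "free_eval h 0 = 0"
  by (simp add: free_eval_def)

lemma free_eval_diff: "free_eval h (f - g) = free_eval h f - free_eval h g"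
  using free_eval_add[of h "f - g" g] by simp

lemma free_eval_sum: "free_eval h (\<Sum>i\<in>I. f i) = (\<Sum>i\<in>I. free_eval h (f i))"
  by (induction I rule: infinite_finite_induct) (simp_all add: free_eval_add)

lemma free_eval_pure_tensor [simp]: "free_eval h \<langle>p\<rangle> = h p"
  by (simp add: free_eval_def pure_tensor_def)

lemma free_eval_diff_fun: "free_eval (\<lambda>p. g p - h p) f = free_eval g f - free_eval h f"
  by (simp add: free_eval_def right_diff_distrib sum_subtractf)

lemma free_eval_cong:
  "(\<And>p. p \<in> Poly_Mapping.keys f \<Longrightarrow> g p = h p) \<Longrightarrow> free_eval g f = free_eval h f"
  by (simp add: free_eval_def)

text \<open>A functional pulls back along a linear substitution. Used twice, this turns the nested
  products \<open>r12_r13\<close>, \<open>r13_r23\<close> and \<open>r23_r12\<close> into iterated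
  scalar sums.\<close>

lemma free_eval_extend: "free_eval h (free_extend g f) = free_eval (\<lambda>p. free_eval h (g p)) f"
  by (simp add: free_extend_def free_eval_sum free_eval_scale) (simp add: free_eval_def)

lemma free_eval_span:
  assumes "\<And>f. f \<in> R \<Longrightarrow> free_eval h f = 0" "f \<in> free.span R"
  shows "free_eval h f = 0"
  using assms(2)
  by (induction rule: free.span_induct_alt) (simp_all add: free_eval_add free_eval_scale assms(1))

lemma free_extend_pure [simp]: "free_extend (\<lambda>p. \<langle>p\<rangle>) f = f"
proof (rule poly_mapping_eqI)
  fix q
  have "Poly_Mapping.lookup (free_extend (\<lambda>p. \<langle>p\<rangle>) f) q =
      (\<Sum>p\<in>Poly_Mapping.keys f. if p = q then Poly_Mapping.lookup f p else 0)"
    unfolding free_extend_def lookup_sum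
    by (rule sum.cong) (auto simp: pure_tensor_def lookup_single)
  then show "Poly_Mapping.lookup (free_extend (\<lambda>p. \<langle>p\<rangle>) f) q = Poly_Mapping.lookup f q"
    by (simp add: in_keys_iff)
qed

lemma free_extend_sum: "free_extend h (\<Sum>i\<in>I. f i) = (\<Sum>i\<in>I. free_extend h (f i))"
  by (induction I rule: infinite_finite_induct)
    (simp_all add: free_extend_add free_extend_def[of h 0])

lemma free_extend_sum_scale_pure:
  "free_extend (\<lambda>p. \<Sum>i\<in>I. free_scale (c i p) \<langle>q i\<rangle>) f =
    (\<Sum>i\<in>I. free_scale (free_eval (c i) f) \<langle>q i\<rangle>)"
  by (simp add: free_extend_def free_eval_def free.scale_sum_right free.scale_sum_left)
    (rule sum.swap)

lemma keys_pure_tensor [simp]: "Poly_Mapping.keys (\<langle>p\<rangle> :: 'b \<Rightarrow>\<^sub>0 'k::field) = {p}"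
  by (simp add: pure_tensor_def)

lemma keys_diff_subset:
  assumes "Poly_Mapping.keys f \<subseteq> S" "Poly_Mapping.keys g \<subseteq> S"
  shows "Poly_Mapping.keys (f - g :: 'b \<Rightarrow>\<^sub>0 'k::field) \<subseteq> S"
proof
  fix p assume "p \<in> Poly_Mapping.keys (f - g)"
  then have "p \<in> Poly_Mapping.keys f \<or> p \<in> Poly_Mapping.keys g"
    by (auto simp: in_keys_iff lookup_minus)
  with assms show "p \<in> S" by blast
qed

lemma keys_add_subset:
  assumes "Poly_Mapping.keys f \<subseteq> S" "Poly_Mapping.keys g \<subseteq> S"
  shows "Poly_Mapping.keys (f + g :: 'b \<Rightarrow>\<^sub>0 'k::field) \<subseteq> S"
  using assms Poly_Mapping.keys_add[of f g] by blast

lemma keys_sum_subset: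
  assumes "\<And>i. i \<in> I \<Longrightarrow> Poly_Mapping.keys (f i :: 'b \<Rightarrow>\<^sub>0 'k::field) \<subseteq> S"
  shows "Poly_Mapping.keys (\<Sum>i\<in>I. f i) \<subseteq> S"
  using assms by (induction I rule: infinite_finite_induct) (simp_all add: keys_add_subset)

lemma keys_free_extend_subset:
  assumes "\<And>p. p \<in> Poly_Mapping.keys f \<Longrightarrow> Poly_Mapping.keys (h p) \<subseteq> S"
  shows "Poly_Mapping.keys (free_extend h f) \<subseteq> S"
proof -
  have "Poly_Mapping.keys (free_scale c g) \<subseteq> Poly_Mapping.keys g" for c and g :: "'c \<Rightarrow>\<^sub>0 'b"
    by (auto simp: in_keys_iff)
  then show ?thesis
    unfolding free_extend_def by (intro keys_sum_subset) (use assms in blast)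
qed

section \<open>Vanishing criterion for threefold tensors\<close>

definition form3 :: "('c \<Rightarrow> 'k) \<Rightarrow> ('c \<Rightarrow> 'k) \<Rightarrow> ('c \<Rightarrow> 'k) \<Rightarrow> 'c \<times> 'c \<times> 'c \<Rightarrow> 'k::field" where
  "form3 \<phi>\<^sub>1 \<phi>\<^sub>2 \<phi>\<^sub>3 = (\<lambda>(x, y, z). \<phi>\<^sub>1 x * \<phi>\<^sub>2 y * \<phi>\<^sub>3 z)"

text \<open>A product of linear forms is multilinear, so it kills every relation. This direction of
  the criterion extracts identities from the GAYBE.\<close>

lemma tensor3_form_zero:
  assumes "linear_form scale C \<phi>\<^sub>1" "linear_form scale C \<phi>\<^sub>2" "linear_form scale C \<phi>\<^sub>3"
    and f: "f \<in> free.span (tensor3_relations scale C)"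
  shows "free_eval (form3 \<phi>\<^sub>1 \<phi>\<^sub>2 \<phi>\<^sub>3) f = 0"
proof (rule free_eval_span[OF _ f])
  note D = linear_formD[OF assms(1)] linear_formD[OF assms(2)] linear_formD[OF assms(3)]
  fix f assume "f \<in> tensor3_relations scale C"
  then show "free_eval (form3 \<phi>\<^sub>1 \<phi>\<^sub>2 \<phi>\<^sub>3) f = 0"
    by (cases rule: tensor3_relations_cases;
        simp only: free_eval_diff free_eval_scale free_eval_pure_tensor form3_def prod.case D;
        simp add: algebra_simps)
qed

text \<open>Induction on the index set, collecting one additivity defect and one scaling defect per
  term. It will be applied to a single tensor factor, the other two held fixed.\<close>

lemma (in vector_space) linear_combination_mod_span:
  assumes C: "subspace C"
    and add: "\<And>x y. x \<in> C \<Longrightarrow> y \<in> C \<Longrightarrow> h (x + y) - h x - h y \<in> free.span R"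
    and scale: "\<And>c x. x \<in> C \<Longrightarrow> h (scale c x) - free_scale c (h x) \<in> free.span R"
    and x: "\<And>i. i \<in> I \<Longrightarrow> x i \<in> C"
  shows "h (\<Sum>i\<in>I. scale (c i) (x i)) - (\<Sum>i\<in>I. free_scale (c i) (h (x i))) \<in> free.span R"
proof -
  \<comment> \<open>Scaling by 0 leaves \<open>h 0\<close> itself as the defect; this settles the
    empty and the infinite index set.\<close>
  have 0: "h 0 \<in> free.span R"
    using scale[OF subspace_0[OF C], of 0] by simp
  show ?thesis
    using x
  proof (induction I rule: infinite_finite_induct)
    case (insert j J)
    let ?s = "\<Sum>i\<in>J. scale (c i) (x i)" and ?t = "\<Sum>i\<in>J. free_scale (c i) (h (x i))"
    have C': "scale (c j) (x j) \<in> C" "?s \<in> C" "x j \<in> C"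
      using insert C by (auto intro!: subspace_sum subspace_scale)
    have "(h (scale (c j) (x j) + ?s) - h (scale (c j) (x j)) - h ?s) +
        ((h (scale (c j) (x j)) - free_scale (c j) (h (x j))) + (h ?s - ?t)) \<in> free.span R"
      using insert by (intro free.span_add add scale C' insert.IH) auto
    with insert show ?case by (simp add: algebra_simps)
  qed (simp_all add: 0)
qed

text \<open>The factors are expanded one at a time in the vectors \<open>b i\<close>; the
  coordinates that accumulate multiply to \<open>form3\<close> of the coordinate maps.\<close>

lemma (in vector_space) pure_tensor3_expansion:
  assumes C: "subspace C" and b: "\<And>i. i \<in> I \<Longrightarrow> b i \<in> C"
    and co: "\<And>x. x \<in> C \<Longrightarrow> x = (\<Sum>i\<in>I. scale (co i x) (b i))"
    and xyz: "x \<in> C" "y \<in> C" "z \<in> C"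
  shows "\<langle>(x, y, z)\<rangle> - (\<Sum>(i, j, k)\<in>I \<times> I \<times> I. free_scale (form3 (co i) (co j) (co k) (x, y, z))
    \<langle>(b i, b j, b k)\<rangle>) \<in> free.span (tensor3_relations scale C)" (is "?T x y z - _ \<in> ?S")
proof -
  have 1: "?T x y z - (\<Sum>i\<in>I. free_scale (co i x) (?T (b i) y z)) \<in> ?S"
    using linear_combination_mod_span[OF C, of "\<lambda>x. ?T x y z" "tensor3_relations scale C" I b "\<lambda>i. co i x"]
    by (simp add: co[OF xyz(1), symmetric] tensor3_relations_span xyz b)
  have 2: "?T x' y z - (\<Sum>i\<in>I. free_scale (co i y) (?T x' (b i) z)) \<in> ?S" if "x' \<in> C" for x'
    using linear_combination_mod_span[OF C, of "\<lambda>y. ?T x' y z" "tensor3_relations scale C" I b "\<lambda>i. co i y"]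
    by (simp add: co[OF xyz(2), symmetric] tensor3_relations_span xyz b that)
  have 3: "?T x' y' z - (\<Sum>i\<in>I. free_scale (co i z) (?T x' y' (b i))) \<in> ?S"
    if "x' \<in> C" "y' \<in> C" for x' y'
    using linear_combination_mod_span[OF C, of "\<lambda>z. ?T x' y' z" "tensor3_relations scale C" I b "\<lambda>i. co i z"]
    by (simp add: co[OF xyz(3), symmetric] tensor3_relations_span xyz b that)
  \<comment> \<open>The sum telescopes: the partial expansions cancel, leaving the pure tensor minus
    its full expansion.\<close>
  have "(?T x y z - (\<Sum>i\<in>I. free_scale (co i x) (?T (b i) y z))) +
     ((\<Sum>i\<in>I. free_scale (co i x) (?T (b i) y z - (\<Sum>j\<in>I. free_scale (co j y) (?T (b i) (b j) z)))) +
     (\<Sum>i\<in>I. free_scale (co i x) (\<Sum>j\<in>I. free_scale (co j y) (?T (b i) (b j) z -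
        (\<Sum>k\<in>I. free_scale (co k z) (?T (b i) (b j) (b k))))))) \<in> ?S"
    by (intro free.span_add free.span_sum free.span_scale 1 2 3 b)
  then show ?thesis
    by (simp add: free.scale_right_diff_distrib free.scale_sum_right sum_subtractf
        sum.cartesian_product form3_def split_def mult.assoc)
qed

text \<open>Modulo the relations, \<open>f\<close> is a combination of the tensors of the
  \<open>b i\<close> whose coefficients are the values of the coordinate products on
  \<open>f\<close>, and these vanish.\<close>

lemma (in vector_space) tensor3_zeroI:
  assumes C: "subspace C" and b: "\<And>i. i \<in> I \<Longrightarrow> b i \<in> C"
    and co: "\<And>x. x \<in> C \<Longrightarrow> x = (\<Sum>i\<in>I. scale (co i x) (b i))"
    and f: "Poly_Mapping.keys f \<subseteq> C \<times> C \<times> C"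
    and zero: "\<And>i j k. i \<in> I \<Longrightarrow> j \<in> I \<Longrightarrow> k \<in> I \<Longrightarrow> free_eval (form3 (co i) (co j) (co k)) f = 0"
  shows "f \<in> free.span (tensor3_relations scale C)"
proof -
  let ?c = "\<lambda>(i, j, k). form3 (co i) (co j) (co k)" and ?q = "\<lambda>(i, j, k). (b i, b j, b k)"
  \<comment> \<open>By \<open>free_extend_pure\<close> this is \<open>f\<close> minus its
    expansion.\<close>
  have "free_extend (\<lambda>p. \<langle>p\<rangle> - (\<Sum>t\<in>I \<times> I \<times> I. free_scale (?c t p) \<langle>?q t\<rangle>)) f
      \<in> free.span (tensor3_relations scale C)"
  proof (rule free_extend_in_span)
    fix p assume "p \<in> Poly_Mapping.keys f"
    with f obtain x y z where "p = (x, y, z)" "x \<in> C" "y \<in> C" "z \<in> C" by auto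
    with pure_tensor3_expansion[where co = co, OF C b co]
    show "\<langle>p\<rangle> - (\<Sum>t\<in>I \<times> I \<times> I. free_scale (?c t p) \<langle>?q t\<rangle>) \<in> free.span (tensor3_relations scale C)"
      by (simp add: split_def)
  qed
  moreover have "(\<Sum>t\<in>I \<times> I \<times> I. free_scale (free_eval (?c t) f) \<langle>?q t\<rangle>) = 0"
    by (rule sum.neutral) (auto simp: zero)
  ultimately show ?thesis
    by (simp add: free_extend_diff_fun free_extend_sum_scale_pure)
qed

section \<open>The semidirect product and its linear forms\<close>

definition semidirect_form :: "('a \<Rightarrow> 'k) \<Rightarrow> 'v \<Rightarrow> 'a \<times> ('v \<Rightarrow> 'k) \<Rightarrow> 'k::field" where
  "semidirect_form g v = (\<lambda>(a, f). g a + f v)"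

locale finite_bimodule_map = bimodule sA sV l r +
  FA: finite_dimensional_vector_space sA BA + FV: finite_dimensional_vector_space sV B
  for sA :: "'k::field \<Rightarrow> 'a::ring \<Rightarrow> 'a" and sV :: "'k \<Rightarrow> 'v::ab_group_add \<Rightarrow> 'v"
    and l r BA B +
  fixes \<alpha> :: "'v \<Rightarrow> 'a"
  assumes linear_map: "Vector_Spaces.linear sV sA \<alpha>"
begin

abbreviation "sH \<equiv> (semidirect_scale sA :: 'k \<Rightarrow> 'a \<times> ('v \<Rightarrow> 'k) \<Rightarrow> _)"
abbreviation "H \<equiv> (semidirect_carrier sV :: ('a \<times> ('v \<Rightarrow> 'k)) set)"
abbreviation "mH \<equiv> semidirect_mul l r :: 'a \<times> ('v \<Rightarrow> 'k) \<Rightarrow> _"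
abbreviation "skew_tensor \<equiv> map_tensor sV B \<alpha> - tensor_flip (map_tensor sV B \<alpha>)"
abbreviation "form_A \<equiv> linear_form sA (UNIV :: 'a set)"

text \<open>The map P of the overview. It vanishes identically exactly when \<alpha> is an
  O-operator, that is, a relative Rota-Baxter operator of weight zero.\<close>

definition defect :: "'v \<Rightarrow> 'v \<Rightarrow> 'a" where
  "defect u v = \<alpha> u * \<alpha> v - \<alpha> (bimodule_star l r \<alpha> u v)"

sublocale HH: algebra_on sH H mH
  by (rule semidirect_algebra_on)

lemma map_simps: "\<alpha> (u + v) = \<alpha> u + \<alpha> v" "\<alpha> (sV c v) = sA c (\<alpha> v)"
  using linear_map by (auto simp: Vector_Spaces.linear_iff)

lemma linear_form_semidirect:
  assumes "form_A g"
  shows "linear_form sH H (semidirect_form g v)"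
  using linear_formD[OF assms UNIV_I]
  by (intro linear_formI) (auto simp: semidirect_form_def semidirect_scale_def
      plus_prod_def algebra_simps)

lemma dual_basis_in_dual: "dual_basis sV B e \<in> dual_space sV"
  unfolding dual_basis_def
  by (rule V.dual_spaceI)
    (simp_all add: V.representation_add V.representation_scale FV.independent_Basis FV.span_Basis)

lemma in_dual_comp:
  assumes "form_A g"
  shows "(\<lambda>v. g (\<alpha> v)) \<in> dual_space sV"
  using linear_formD[OF assms UNIV_I] by (intro V.dual_spaceI) (simp_all add: map_simps)

lemma sum_dual_basis: "(\<Sum>e\<in>B. sV (dual_basis sV B e v) e) = v"
  unfolding dual_basis_def
  using V.sum_representation_eq[OF FV.independent_Basis, of v B] FV.span_Basis FV.finite_Basis
  by simp

lemma sum_dual_basis_eval: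
  assumes "f \<in> dual_space sV"
  shows "(\<Sum>e\<in>B. f e * dual_basis sV B e v) = f v"
proof -
  have "linear_form sV UNIV f"
    using dual_spaceD[OF assms] by (intro linear_formI) simp_all
  from V.linear_form_sum[OF V.subspace_UNIV this, of B "\<lambda>e. e" "\<lambda>e. dual_basis sV B e v"]
  show ?thesis by (simp add: sum_dual_basis mult.commute)
qed

lemma zero_in_dual: "0 \<in> dual_space sV"
  by (rule V.dual_spaceI) auto

section \<open>The tensor and its skew-symmetry\<close>

lemma skew_tensor_eq:
  "skew_tensor = (\<Sum>e\<in>B. \<langle>((\<alpha> e, 0), (0, dual_basis sV B e))\<rangle>)
    - (\<Sum>e\<in>B. \<langle>((0, dual_basis sV B e), (\<alpha> e, 0))\<rangle>)"
  by (simp add: map_tensor_def tensor_flip_def free_extend_sum)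

lemma keys_skew_tensor: "Poly_Mapping.keys skew_tensor \<subseteq> H \<times> H"
  unfolding skew_tensor_eq
  by (intro keys_diff_subset keys_sum_subset)
    (auto simp: semidirect_carrier_def dual_basis_in_dual zero_in_dual)

text \<open>The flip exchanges the two sums of the representative, so the equality holds already in
  the free vector space.\<close>

lemma skew_symmetric_skew_tensor: "skew_symmetric sH H skew_tensor"
proof -
  have "tensor_flip skew_tensor = - skew_tensor"
    unfolding skew_tensor_eq by (simp add: tensor_flip_def free_extend_diff free_extend_sum)
  then show ?thesis
    using keys_skew_tensor
    by (simp add: skew_symmetric_def tensor2_def tensor2_eq_def free.span_zero)
qed

section \<open>Contracting one tensor factor with a linear form\<close>

definition contraction :: "('a \<Rightarrow> 'k) \<Rightarrow> 'v \<Rightarrow> 'a \<times> ('v \<Rightarrow> 'k)" where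
  "contraction g v = (\<alpha> v, - (\<lambda>u. g (\<alpha> u)))"

lemma contraction_in: "form_A g \<Longrightarrow> contraction g v \<in> H"
  using HH.subspace_diff[OF HH.subspace_carrier, of "(\<alpha> v, 0)" "(0, \<lambda>u. g (\<alpha> u))"]
  by (simp add: contraction_def semidirect_carrier_def zero_in_dual in_dual_comp)

text \<open>Expanding \<open>v\<close> in the basis yields \<alpha>(v), and expanding the form g o
  \<alpha> in the dual basis has coefficients g(\<alpha>(e)); linearity of \<open>F\<close>
  reassembles both sums. The minus sign is that of \<open>\<alpha>\<^sup>2\<^sup>1\<close>.\<close>

lemma contraction_sum:
  assumes g: "form_A g" and F: "linear_form sH H F"
  shows "(\<Sum>e\<in>B. dual_basis sV B e v * F (\<alpha> e, 0)) - (\<Sum>e\<in>B. g (\<alpha> e) * F (0, dual_basis sV B e))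
    = F (contraction g v)"
proof -
  have in_H: "(a, 0) \<in> H" "(0, dual_basis sV B e) \<in> H" "(0, \<lambda>u. g (\<alpha> u)) \<in> H" for a e
    by (auto simp: semidirect_carrier_def zero_in_dual dual_basis_in_dual in_dual_comp g)
  have "\<alpha> v = (\<Sum>e\<in>B. sA (dual_basis sV B e v) (\<alpha> e))"
  proof -
    interpret L: Vector_Spaces.linear sV sA \<alpha> by (rule linear_map)
    show ?thesis
      using arg_cong[OF sum_dual_basis[of v], of \<alpha>] by (simp add: L.sum L.scale)
  qed
  then have 1: "(\<Sum>e\<in>B. sH (dual_basis sV B e v) (\<alpha> e, 0)) = (\<alpha> v, 0)"
    by (simp add: semidirect_scale_def sum_prod fun_eq_iff zero_fun_def sum_fun_apply)
  have 2: "(\<Sum>e\<in>B. sH (g (\<alpha> e)) (0, dual_basis sV B e)) = (0, \<lambda>u. g (\<alpha> u))"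
    using sum_dual_basis_eval[OF in_dual_comp[OF g]]
    by (simp add: semidirect_scale_def sum_prod fun_eq_iff sum_fun_apply)
  have "F (\<alpha> v, 0) = (\<Sum>e\<in>B. dual_basis sV B e v * F (\<alpha> e, 0))"
    "F (0, \<lambda>u. g (\<alpha> u)) = (\<Sum>e\<in>B. g (\<alpha> e) * F (0, dual_basis sV B e))"
    unfolding 1[symmetric] 2[symmetric]
    by (rule HH.linear_form_sum[OF HH.subspace_carrier F], rule in_H)+
  moreover have "F (\<alpha> v, 0) - F (0, \<lambda>u. g (\<alpha> u)) = F (contraction g v)"
    using HH.linear_form_diff[OF HH.subspace_carrier F, of "(\<alpha> v, 0)" "(0, \<lambda>u. g (\<alpha> u))"]
    by (simp add: in_H contraction_def)
  ultimately show ?thesis by simp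
qed

lemma contract_right:
  assumes "form_A g" "linear_form sH H F"
  shows "free_eval (\<lambda>(a, b). F a * semidirect_form g v b) skew_tensor = F (contraction g v)"
  unfolding contraction_sum[OF assms, symmetric] skew_tensor_eq
  \<comment> \<open>This supplies \<open>g 0 = 0\<close>, for the tensor factors with zero
    \<open>A\<close>-component.\<close>
  using linear_formD(2)[OF assms(1) UNIV_I, of 0 0]
  by (simp add: free_eval_diff free_eval_sum semidirect_form_def mult.commute)

lemma contract_left:
  assumes "form_A g" "linear_form sH H F"
  shows "free_eval (\<lambda>(a, b). semidirect_form g v a * F b) skew_tensor = - F (contraction g v)"
  unfolding contraction_sum[OF assms, symmetric] skew_tensor_eq
  using linear_formD(2)[OF assms(1) UNIV_I, of 0 0]
  by (simp add: free_eval_diff free_eval_sum semidirect_form_def mult.commute)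

text \<open>The scalar \<open>c\<close> absorbs factors that stay constant during an inner
  evaluation, and the sign left by an earlier contraction.\<close>

lemma linear_form_mul:
  assumes "linear_form sH H F" "b \<in> H"
  shows "linear_form sH H (\<lambda>a. c * F (mH a b))" "linear_form sH H (\<lambda>a. c * F (mH b a))"
  by (rule linear_formI; simp add: assms(2) HH.mul_closed HH.mul_add_left HH.mul_add_right
      HH.mul_scale_left HH.mul_scale_right linear_formD[OF assms(1)] distrib_left)+

section \<open>Evaluating the Yang-Baxter expression on products of forms\<close>

abbreviation "YB \<equiv> r12_r13 mH skew_tensor + r13_r23 mH skew_tensor - r23_r12 mH skew_tensor"

text \<open>The inner copy of the tensor is contracted first, then the outer one. Each contraction
  of a first factor costs a sign: none occurs for \<open>r12_r13\<close>, two for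
  \<open>r13_r23\<close>, and one for \<open>r23_r12\<close>, which cancels against the
  subtraction.\<close>

lemma form3_YB_contraction:
  fixes u v w :: 'v
  assumes g: "form_A g\<^sub>1" "form_A g\<^sub>2" "form_A g\<^sub>3"
  defines "\<phi>\<^sub>1 \<equiv> semidirect_form g\<^sub>1 u" and "\<phi>\<^sub>2 \<equiv> semidirect_form g\<^sub>2 v"
    and "\<phi>\<^sub>3 \<equiv> semidirect_form g\<^sub>3 w"
    and "s\<^sub>1 \<equiv> contraction g\<^sub>1 u" and "s\<^sub>2 \<equiv> contraction g\<^sub>2 v" and "s\<^sub>3 \<equiv> contraction g\<^sub>3 w"
  shows "free_eval (form3 \<phi>\<^sub>1 \<phi>\<^sub>2 \<phi>\<^sub>3) YB = \<phi>\<^sub>1 (mH s\<^sub>2 s\<^sub>3) + \<phi>\<^sub>2 (mH s\<^sub>3 s\<^sub>1) + \<phi>\<^sub>3 (mH s\<^sub>1 s\<^sub>2)"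
proof -
  let ?t = skew_tensor
  have \<phi>: "linear_form sH H \<phi>\<^sub>1" "linear_form sH H \<phi>\<^sub>2" "linear_form sH H \<phi>\<^sub>3"
    unfolding \<phi>\<^sub>1_def \<phi>\<^sub>2_def \<phi>\<^sub>3_def by (intro linear_form_semidirect g)+
  have s: "s\<^sub>1 \<in> H" "s\<^sub>2 \<in> H" "s\<^sub>3 \<in> H"
    unfolding s\<^sub>1_def s\<^sub>2_def s\<^sub>3_def by (intro contraction_in g)+
  note right = contract_right[OF g(1), of _ u, folded \<phi>\<^sub>1_def s\<^sub>1_def]
    contract_right[OF g(2), of _ v, folded \<phi>\<^sub>2_def s\<^sub>2_def]
    contract_right[OF g(3), of _ w, folded \<phi>\<^sub>3_def s\<^sub>3_def]
  note left = contract_left[OF g(1), of _ u, folded \<phi>\<^sub>1_def s\<^sub>1_def]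
    contract_left[OF g(2), of _ v, folded \<phi>\<^sub>2_def s\<^sub>2_def]
    contract_left[OF g(3), of _ w, folded \<phi>\<^sub>3_def s\<^sub>3_def]
  \<comment> \<open>The tensor is supported on pairs from \<open>H\<close>, so the inner value is
    needed only for \<open>a\<close> and \<open>b\<close> in \<open>H\<close>, where the forms are
    linear.\<close>
  have ev: "free_eval (\<lambda>(a, b). free_eval (k a b) ?t) ?t = free_eval (\<lambda>(a, b). h a b) ?t"
    if "\<And>a b. a \<in> H \<Longrightarrow> b \<in> H \<Longrightarrow> free_eval (k a b) ?t = h a b" for k h
    by (rule free_eval_cong) (use keys_skew_tensor that in auto)
  have "free_eval (form3 \<phi>\<^sub>1 \<phi>\<^sub>2 \<phi>\<^sub>3) (r12_r13 mH ?t) =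
      free_eval (\<lambda>(a, b). free_eval (\<lambda>(a', b'). \<phi>\<^sub>2 b * \<phi>\<^sub>1 (mH a a') * \<phi>\<^sub>3 b') ?t) ?t"
    by (simp add: r12_r13_def free_eval_extend form3_def split_def mult_ac)
  also have "\<dots> = free_eval (\<lambda>(a, b). \<phi>\<^sub>2 b * \<phi>\<^sub>1 (mH a s\<^sub>3)) ?t"
    by (intro ev right linear_form_mul \<phi>)
  also have "\<dots> = \<phi>\<^sub>1 (mH s\<^sub>2 s\<^sub>3)"
    using right(2)[OF linear_form_mul(1)[OF \<phi>(1) s(3), of 1]] by (simp add: mult.commute)
  finally have 1: "free_eval (form3 \<phi>\<^sub>1 \<phi>\<^sub>2 \<phi>\<^sub>3) (r12_r13 mH ?t) = \<phi>\<^sub>1 (mH s\<^sub>2 s\<^sub>3)" .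
  have "free_eval (form3 \<phi>\<^sub>1 \<phi>\<^sub>2 \<phi>\<^sub>3) (r13_r23 mH ?t) =
      free_eval (\<lambda>(a, b). free_eval (\<lambda>(a', b'). \<phi>\<^sub>2 a' * (\<phi>\<^sub>1 a * \<phi>\<^sub>3 (mH b b'))) ?t) ?t"
    by (simp add: r13_r23_def free_eval_extend form3_def split_def mult_ac)
  also have "\<dots> = free_eval (\<lambda>(a, b). - (\<phi>\<^sub>1 a * \<phi>\<^sub>3 (mH b s\<^sub>2))) ?t"
    by (intro ev left linear_form_mul \<phi>)
  also have "\<dots> = \<phi>\<^sub>3 (mH s\<^sub>1 s\<^sub>2)"
    using left(1)[OF linear_form_mul(1)[OF \<phi>(3) s(2), of "-1"]] by simp
  finally have 2: "free_eval (form3 \<phi>\<^sub>1 \<phi>\<^sub>2 \<phi>\<^sub>3) (r13_r23 mH ?t) = \<phi>\<^sub>3 (mH s\<^sub>1 s\<^sub>2)" .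
  have "free_eval (form3 \<phi>\<^sub>1 \<phi>\<^sub>2 \<phi>\<^sub>3) (r23_r12 mH ?t) =
      free_eval (\<lambda>(a, b). free_eval (\<lambda>(a', b'). \<phi>\<^sub>1 a * \<phi>\<^sub>2 (mH a' b) * \<phi>\<^sub>3 b') ?t) ?t"
    by (simp add: r23_r12_def free_eval_extend form3_def split_def mult_ac)
  also have "\<dots> = free_eval (\<lambda>(a, b). \<phi>\<^sub>1 a * \<phi>\<^sub>2 (mH s\<^sub>3 b)) ?t"
    by (intro ev right linear_form_mul \<phi>)
  also have "\<dots> = - \<phi>\<^sub>2 (mH s\<^sub>3 s\<^sub>1)"
    using left(1)[OF linear_form_mul(2)[OF \<phi>(2) s(3), of 1]] by simp
  finally show ?thesis
    using 1 2 by (simp add: free_eval_add free_eval_diff)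
qed

text \<open>Collect the terms in each form. For \<open>g\<^sub>1\<close>, the first product gives
  \<alpha>(v) \<alpha>(w), while the dual components of the second and third give the parts
  \<open>r (\<alpha> w) v\<close> and \<open>l (\<alpha> v) w\<close> of the star product; the rest
  is cyclic.\<close>

lemma form3_YB:
  assumes g: "form_A g\<^sub>1" "form_A g\<^sub>2" "form_A g\<^sub>3"
  shows "free_eval (form3 (semidirect_form g\<^sub>1 u) (semidirect_form g\<^sub>2 v) (semidirect_form g\<^sub>3 w)) YB
    = g\<^sub>1 (defect v w) + g\<^sub>2 (defect w u) + g\<^sub>3 (defect u v)"
  unfolding form3_YB_contraction[OF g]
  by (simp add: semidirect_form_def contraction_def semidirect_mul_def defect_def dual_left_def
      dual_right_def bimodule_star_def map_simps linear_formD[OF g(1)] linear_formD[OF g(2)]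
      linear_formD[OF g(3)] A.linear_form_diff[OF A.subspace_UNIV g(1)]
      A.linear_form_diff[OF A.subspace_UNIV g(2)] A.linear_form_diff[OF A.subspace_UNIV g(3)])

section \<open>Moving the multiplications by \<open>x\<close> onto the forms\<close>

lemma free_eval_LR_op:
  "free_eval (form3 \<phi>\<^sub>1 \<phi>\<^sub>2 \<phi>\<^sub>3) (LR_op m x f) =
    free_eval (form3 \<phi>\<^sub>1 \<phi>\<^sub>2 (\<lambda>s. \<phi>\<^sub>3 (m x s))) f - free_eval (form3 (\<lambda>p. \<phi>\<^sub>1 (m p x)) \<phi>\<^sub>2 \<phi>\<^sub>3) f"
  by (simp add: LR_op_def free_eval_extend free_eval_diff form3_def split_def
      flip: free_eval_diff_fun)

text \<open>The \<open>A\<close>-part of the multiplier acts on the vector and on \<open>g\<close>,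
  whereas its dual part \<open>\<psi>\<close> enters only the form on \<open>A\<close>.\<close>

lemma semidirect_form_mul:
  "(\<lambda>X. semidirect_form g w (mH (a, \<psi>) X)) =
    semidirect_form (\<lambda>b. g (a * b) + \<psi> (l b w)) (r a w)"
  "(\<lambda>X. semidirect_form g u (mH X (a, \<psi>))) =
    semidirect_form (\<lambda>b. g (b * a) + \<psi> (r b u)) (l a u)"
  by (auto simp: fun_eq_iff semidirect_form_def semidirect_mul_def dual_left_def dual_right_def)

lemma form_A_mul:
  assumes "form_A g" "\<psi> \<in> dual_space sV"
  shows "form_A (\<lambda>b. g (a * b) + \<psi> (l b w))" "form_A (\<lambda>b. g (b * a) + \<psi> (r b w))"
  by (rule linear_formI; simp add: algebra_simps l_add r_add l_scale r_scale
      linear_formD[OF assms(1)] dual_spaceD[OF assms(2)] A.mul_scale_left A.mul_scale_right)+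

text \<open>Two instances of \<open>form3_YB\<close> are subtracted: one with \<open>w\<close>
  replaced by \<open>r a w\<close>, the other with \<open>u\<close> replaced by
  \<open>l a u\<close>. Each bracket is one of the four identities.\<close>

lemma form3_LR_YB:
  assumes g: "form_A g\<^sub>1" "form_A g\<^sub>2" "form_A g\<^sub>3" and \<psi>: "\<psi> \<in> dual_space sV"
  shows "free_eval (form3 (semidirect_form g\<^sub>1 u) (semidirect_form g\<^sub>2 v) (semidirect_form g\<^sub>3 w))
      (LR_op mH (a, \<psi>) YB) =
    (g\<^sub>1 (defect v (r a w)) - g\<^sub>1 (defect v w * a)) +
    (g\<^sub>2 (defect (r a w) u) - g\<^sub>2 (defect w (l a u))) +
    (g\<^sub>3 (a * defect u v) - g\<^sub>3 (defect (l a u) v)) +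
    (\<psi> (l (defect u v) w) - \<psi> (r (defect v w) u))"
  unfolding free_eval_LR_op semidirect_form_mul
  by (subst (1 2) form3_YB) (simp_all add: g form_A_mul \<psi>)

section \<open>Equivalence of the GAYBE with the four identities\<close>

definition defect_conditions :: bool where
  "defect_conditions \<longleftrightarrow> (\<forall>u v w x.
    l (defect u v) w = r (defect v w) u \<and>
    defect u (l x v) = defect (r x u) v \<and>
    defect u (r x v) = defect u v * x \<and>
    defect (l x u) v = x * defect u v)"

lemma form_A_zero: "form_A (\<lambda>_. 0)"
  by (rule linear_formI) simp_all

lemma form_A_coordinate: "form_A (\<lambda>a. A.representation BA a b)"
  by (rule linear_formI)
    (simp_all add: A.representation_add A.representation_scale FA.independent_Basis FA.span_Basis)

lemma sum_coordinates: "(\<Sum>b\<in>BA. sA (A.representation BA a b) b) = a"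
  by (rule A.sum_representation_eq)
    (simp_all add: FA.independent_Basis FA.span_Basis FA.finite_Basis)

lemma form_A_separate:
  assumes "\<And>g. form_A g \<Longrightarrow> g x = g y"
  shows "x = y"
proof -
  have "A.representation BA x b = A.representation BA y b" for b
    by (rule assms[OF form_A_coordinate])
  then have "(\<Sum>b\<in>BA. sA (A.representation BA x b) b) = (\<Sum>b\<in>BA. sA (A.representation BA y b) b)"
    by (intro sum.cong refl) (simp only:)
  then show ?thesis by (simp only: sum_coordinates)
qed

lemma dual_separate:
  assumes "\<And>f. f \<in> dual_space sV \<Longrightarrow> f x = f y"
  shows "x = y"
proof -
  have "dual_basis sV B e x = dual_basis sV B e y" for e
    by (rule assms[OF dual_basis_in_dual])
  then have "(\<Sum>e\<in>B. sV (dual_basis sV B e x) e) = (\<Sum>e\<in>B. sV (dual_basis sV B e y) e)"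
    by (intro sum.cong refl) (simp only:)
  then show ?thesis by (simp only: sum_dual_basis)
qed

text \<open>Prepares \<open>tensor3_zeroI\<close>, which expands only pure tensors with all factors
  in \<open>H\<close>.\<close>

lemma keys_YB: "Poly_Mapping.keys YB \<subseteq> H \<times> H \<times> H"
proof -
  \<comment> \<open>The pattern \<open>q\<close> covers the three products at once.\<close>
  have "Poly_Mapping.keys (free_extend (\<lambda>(a, b). free_extend (\<lambda>(a', b'). \<langle>q a b a' b'\<rangle>) skew_tensor)
      skew_tensor) \<subseteq> H \<times> H \<times> H"
    if "\<And>a b a' b'. a \<in> H \<Longrightarrow> b \<in> H \<Longrightarrow> a' \<in> H \<Longrightarrow> b' \<in> H \<Longrightarrow> q a b a' b' \<in> H \<times> H \<times> H" for q
  proof (rule keys_free_extend_subset)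
    fix p assume "p \<in> Poly_Mapping.keys skew_tensor"
    from subsetD[OF keys_skew_tensor this] obtain a b where p: "p = (a, b)" "a \<in> H" "b \<in> H"
      by (rule SigmaE)
    show "Poly_Mapping.keys (case p of (a, b) \<Rightarrow>
        free_extend (\<lambda>(a', b'). \<langle>q a b a' b'\<rangle>) skew_tensor) \<subseteq> H \<times> H \<times> H"
      unfolding p(1) prod.case
    proof (rule keys_free_extend_subset)
      fix p' assume "p' \<in> Poly_Mapping.keys skew_tensor"
      from subsetD[OF keys_skew_tensor this] obtain a' b' where
        p': "p' = (a', b')" "a' \<in> H" "b' \<in> H" by (rule SigmaE)
      show "Poly_Mapping.keys (case p' of (a', b') \<Rightarrow> \<langle>q a b a' b'\<rangle>) \<subseteq> H \<times> H \<times> H"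
        unfolding p'(1) prod.case keys_pure_tensor using that[OF p(2,3) p'(2,3)] by blast
    qed
  qed
  then show ?thesis
    unfolding r12_r13_def r13_r23_def r23_r12_def
    by (intro keys_diff_subset keys_add_subset) (simp_all add: HH.mul_closed)
qed

lemma keys_LR_YB:
  assumes "x \<in> H"
  shows "Poly_Mapping.keys (LR_op mH x YB) \<subseteq> H \<times> H \<times> H"
  unfolding LR_op_def
proof (rule keys_free_extend_subset)
  fix t assume "t \<in> Poly_Mapping.keys YB"
  with keys_YB obtain p q s where "t = (p, q, s)" "p \<in> H" "q \<in> H" "s \<in> H" by blast
  with assms show "Poly_Mapping.keys ((case t of (p, q, s) \<Rightarrow>
      \<langle>(p, q, mH x s)\<rangle> - \<langle>(mH p x, q, s)\<rangle>) :: _ \<Rightarrow>\<^sub>0 'k) \<subseteq> H \<times> H \<times> H"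
    by (simp add: keys_diff_subset HH.mul_closed)
qed

text \<open>Coordinates on \<open>H\<close>, indexed by \<open>BA <+> B\<close>. The vector 0 makes
  an \<open>Inl\<close> form ignore the dual component, and evaluation at \<open>e\<close> is the
  coordinate along the dual basis vector of \<open>e\<close>.\<close>

fun basis_form :: "'a + 'v \<Rightarrow> 'a \<times> ('v \<Rightarrow> 'k) \<Rightarrow> 'k" where
  "basis_form (Inl b) = semidirect_form (\<lambda>a. A.representation BA a b) 0"
| "basis_form (Inr e) = semidirect_form (\<lambda>_. 0) e"

fun basis_vector :: "'a + 'v \<Rightarrow> 'a \<times> ('v \<Rightarrow> 'k)" where
  "basis_vector (Inl b) = (b, 0)"
| "basis_vector (Inr e) = (0, dual_basis sV B e)"

lemma GAYBE_skew_tensor_iff: "GAYBE_solution sH H mH skew_tensor \<longleftrightarrow> defect_conditions"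
proof
  assume "GAYBE_solution sH H mH skew_tensor"
  then have "LR_op mH (a, \<psi>) YB \<in> free.span (tensor3_relations sH H)"
    if "\<psi> \<in> dual_space sV" for a \<psi>
    using that by (simp add: GAYBE_solution_def tensor3_eq_def semidirect_carrier_def)
  from tensor3_form_zero[OF linear_form_semidirect linear_form_semidirect linear_form_semidirect this]
  have *: "(g\<^sub>1 (defect v (r a w)) - g\<^sub>1 (defect v w * a)) +
    (g\<^sub>2 (defect (r a w) u) - g\<^sub>2 (defect w (l a u))) +
    (g\<^sub>3 (a * defect u v) - g\<^sub>3 (defect (l a u) v)) +
    (\<psi> (l (defect u v) w) - \<psi> (r (defect v w) u)) = 0"
    if "form_A g\<^sub>1" "form_A g\<^sub>2" "form_A g\<^sub>3" "\<psi> \<in> dual_space sV" for g\<^sub>1 g\<^sub>2 g\<^sub>3 \<psi> a u v w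
    using that form3_LR_YB[OF that] by metis
  show defect_conditions
    unfolding defect_conditions_def
  proof (intro allI conjI)
    \<comment> \<open>Each time all but one of \<open>g\<^sub>1\<close>, \<open>g\<^sub>2\<close>,
      \<open>g\<^sub>3\<close>, \<open>\<psi>\<close> are zero, leaving one bracket; the remaining
      form is arbitrary and separates points.\<close>
    fix u v w x
    show "l (defect u v) w = r (defect v w) u"
      by (rule dual_separate) (use *[OF form_A_zero form_A_zero form_A_zero] in auto)
    show "defect u (l x v) = defect (r x u) v"
      by (rule form_A_separate[symmetric]) (use *[OF form_A_zero _ form_A_zero zero_in_dual] in auto)
    show "defect u (r x v) = defect u v * x"
      by (rule form_A_separate) (use *[OF _ form_A_zero form_A_zero zero_in_dual] in auto)
    show "defect (l x u) v = x * defect u v"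
      by (rule form_A_separate[symmetric]) (use *[OF form_A_zero form_A_zero _ zero_in_dual] in auto)
  qed
next
  assume *: defect_conditions
  have "LR_op mH x YB \<in> free.span (tensor3_relations sH H)" if x: "x \<in> H" for x
  proof (rule HH.tensor3_zeroI[OF HH.subspace_carrier])
    show "Poly_Mapping.keys (LR_op mH x YB) \<subseteq> H \<times> H \<times> H" by (rule keys_LR_YB[OF x])
    show "basis_vector i \<in> H" if "i \<in> BA <+> B" for i
      by (cases i) (simp_all add: semidirect_carrier_def zero_in_dual dual_basis_in_dual)
    show "y = (\<Sum>i\<in>BA <+> B. sH (basis_form i y) (basis_vector i))" if yH: "y \<in> H" for y
    proof -
      obtain a f where y: "y = (a, f)" and f: "f \<in> dual_space sV"
        using yH by (auto simp: semidirect_carrier_def)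
      have "(\<Sum>e\<in>B. (\<lambda>v. f e * dual_basis sV B e v)) = f"
        by (simp add: fun_eq_iff sum_fun_apply sum_dual_basis_eval f)
      moreover have "f 0 = 0"
        using dual_spaceD(2)[OF f, of 0 0] by simp
      ultimately show ?thesis
        by (simp add: y sum.Plus FA.finite_Basis FV.finite_Basis semidirect_form_def
            semidirect_scale_def sum_prod sum_coordinates flip: zero_fun_def)
    qed
    obtain a \<psi> where "x = (a, \<psi>)" "\<psi> \<in> dual_space sV"
      using x by (auto simp: semidirect_carrier_def)
    then have zero: "free_eval (form3 (semidirect_form g\<^sub>1 u) (semidirect_form g\<^sub>2 v)
        (semidirect_form g\<^sub>3 w)) (LR_op mH x YB) = 0"
      if "form_A g\<^sub>1" "form_A g\<^sub>2" "form_A g\<^sub>3" for g\<^sub>1 g\<^sub>2 g\<^sub>3 u v w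
      using form3_LR_YB[OF that] * by (simp add: defect_conditions_def)
    \<comment> \<open>Coordinate forms are semidirect forms, so \<open>zero\<close> applies to every
      triple of them.\<close>
    have "\<exists>g v. form_A g \<and> basis_form i = semidirect_form g v" for i
      by (cases i) (auto intro: form_A_zero form_A_coordinate)
    with zero show "free_eval (form3 (basis_form i) (basis_form j) (basis_form k)) (LR_op mH x YB) = 0"
      for i j k
      by metis
  qed
  then show "GAYBE_solution sH H mH skew_tensor"
    using keys_skew_tensor by (simp add: GAYBE_solution_def tensor2_def tensor3_eq_def)
qed

end

theorem theorem4p7:
  fixes sA :: "'k::field \<Rightarrow> 'a::ring \<Rightarrow> 'a"
    and sV :: "'k \<Rightarrow> 'v::ab_group_add \<Rightarrow> 'v"
    and l r :: "'a \<Rightarrow> 'v \<Rightarrow> 'v"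
    and \<alpha> :: "'v \<Rightarrow> 'a"
    and BA :: "'a set" and B :: "'v set"
  defines "star \<equiv> bimodule_star l r \<alpha>"
    and "\<alpha>\<^sub>t \<equiv> map_tensor sV B \<alpha>"
  assumes algebra: "algebra_on sA UNIV (*)"
    and bimodule: "bimodule sA sV l r"
    and fin_A: "finite_dimensional_vector_space sA BA"
    and fin_V: "finite_dimensional_vector_space sV B"
    and linear: "Vector_Spaces.linear sV sA \<alpha>"
  shows "skew_symmetric (semidirect_scale sA) (semidirect_carrier sV) (\<alpha>\<^sub>t - tensor_flip \<alpha>\<^sub>t) \<and>
      GAYBE_solution (semidirect_scale sA) (semidirect_carrier sV) (semidirect_mul l r)
        (\<alpha>\<^sub>t - tensor_flip \<alpha>\<^sub>t)
    \<longleftrightarrow>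
      (\<forall>u v w x.
        l (\<alpha> u * \<alpha> v - \<alpha> (star u v)) w = r (\<alpha> v * \<alpha> w - \<alpha> (star v w)) u \<and>
        \<alpha> u * \<alpha> (l x v) - \<alpha> (star u (l x v)) = \<alpha> (r x u) * \<alpha> v - \<alpha> (star (r x u) v) \<and>
        \<alpha> u * \<alpha> (r x v) - \<alpha> (star u (r x v)) = (\<alpha> u * \<alpha> v) * x - \<alpha> (star u v) * x \<and>
        \<alpha> (l x u) * \<alpha> v - \<alpha> (star (l x u) v) = x * (\<alpha> u * \<alpha> v) - x * \<alpha> (star u v))"
proof -
  interpret finite_bimodule_map sA sV l r BA B \<alpha>
    using bimodule fin_A fin_V linear
    by (simp add: finite_bimodule_map_def finite_bimodule_map_axioms_def)
  show ?thesis
    \<comment> \<open>Skew-symmetry holds for every linear \<alpha>, so the conjunction reduces to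
      the GAYBE; the distributive laws expand products of \<open>defect\<close> with
      \<open>x\<close>.\<close>
    using skew_symmetric_skew_tensor GAYBE_skew_tensor_iff
    by (simp add: star_def \<alpha>\<^sub>t_def defect_conditions_def defect_def left_diff_distrib
        right_diff_distrib)
qed

end
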